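(* Suppose $C_2\ge C_1$. Consider decision states $(i,k,\ell)$, i.e. $(i,k,\ell)\in\mathbb{X}$ with $i\ge1$ (so $k+\ell=C_1$). 1. Suppose $\frac{h_1}{\mu_1}\ge\frac{h_2}{\mu_2}$. (a) If $\mu_1\le\mu_2$, it is optimal to choose collaborative service in every decision state, whichever station completes a job first. (b) If $\mu_1>\mu_2$, there exist finite thresholds $N_1(\ell)\in\mathbb{Z}_+$ depending on $\ell$ only ($0\le\ell\le C_1-1$) such that: if a Station 1 job is completed first (so $k\ge1$), there is an optimal policy of collaborative threshold type with threshold $N_1(\ell)+1$ (collaborative service is optimal if $i<N_1(\ell)+1$, independent service is optimal otherwise), and if moreover $\frac{h_1}{\mu_1}\le\frac{\ell+1}{C_2}\frac{h_2}{\mu_2}$ then independent service is optimal for every $i\ge1$; if a Station 2 job is completed first (so $\ell\ge1$), there is an optimal policy of collaborative threshold type with threshold $N_1(\ell-1)+1$, and if moreover $\frac{h_1}{\mu_1}\le\frac{\ell}{C_2}\frac{h_2}{\mu_2}$ then independent service is optimal for every $i\ge1$. 2. Suppose $\frac{h_1}{\mu_1}\le\frac{h_2}{\mu_2}$. (a) If $\mu_1<\mu_2$, there exist finite thresholds $N_3(\ell)\in\mathbb{Z}_+$ depending on $\ell$ only ($0\le\ell\le C_1-1$) such that: if a Station 1 job is completed first, there is an optimal policy of independent threshold type with threshold $N_3(\ell)+1$ (independent service is optimal if $i<N_3(\ell)+1$, collaborative service is optimal otherwise); if a Station 2 job is completed first, there is an optimal policy of independent threshold type with threshold $N_3(\ell-1)+1$.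 (b) If $\mu_1\ge\mu_2$, it is optimal to choose independent service in every decision state, whichever station completes a job first. 3. If $(i,k,\ell)$ and $(i,k+1,\ell-1)$ are both decision states, then: when a Station 1 job finishes first (with $k\ge1$), if collaborative service is optimal at $(i,k,\ell)$ it is also optimal at $(i,k+1,\ell-1)$; and the same implication holds when a Station 2 job finishes first (with $\ell-1\ge1$).
   Context: Let $C_1,C_2\ge1$ be integers (numbers of Type-I and Type-II servers), $\mu_1,\mu_2>0$ (service rates at Station 1, the independent service station, and Station 2, the collaborative service station) and $h_0,h_1,h_2>0$ (holding costs per job per unit time in the initial queue, at Station 1 and at Station 2). Write $\mathbb{Z}_+=\{0,1,2,\dots\}$. The state space is $$\mathbb{X}=\{(i,k,\ell)\in\mathbb{Z}_+^3 : (i=0 \text{ and } k+\ell<C_1)\text{ or }(i\ge0\text{ and }k+\ell=C_1)\},$$ where $i$ is the number of jobs in the initial queue, $k$ the number of jobs in service at Station 1 and $\ell$ the number of jobs at Station 2. There are no arrivals. Service is non-preemptive with exponential times: Station 1 completes services at total rate $k\mu_1$ and Station 2 at total rate $\min\{\ell,C_2\}\mu_2$; put $d(k,\ell)=k\mu_1+\min\{\ell,C_2\}\mu_2$. Decisions: in a state $(i,k,\ell)$ with $i\ge1$, when a service completes the freed Type-I server takes the next queued job and chooses independent service (Station 1) or collaborative service (Station 2). If a Station 1 job is completed first, the next state is $(i-1,k,\ell)$ under independent and $(i-1,k-1,\ell+1)$ under collaborative service. If a Station 2 job is completed first, the next state is $(i-1,k+1,\ell-1)$ under independent and $(i-1,k,\ell)$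 under collaborative service. The value function $v:\mathbb{X}\to\mathbb{R}$ is the minimal expected total holding cost until the system is empty. It satisfies $v(0,0,0)=0$, $$v(0,k,\ell)=\tfrac{kh_1+\ell h_2}{d(k,\ell)}+\tfrac{k\mu_1}{d(k,\ell)}v(0,k-1,\ell)+\tfrac{\min\{\ell,C_2\}\mu_2}{d(k,\ell)}v(0,k,\ell-1)\quad ((k,\ell)\ne(0,0)),$$ and for $i\ge1$, $$v(i,k,\ell)=\tfrac{ih_0+kh_1+\ell h_2}{d(k,\ell)}+\tfrac{k\mu_1}{d(k,\ell)}\min\{v(i-1,k,\ell),v(i-1,k-1,\ell+1)\}+\tfrac{\min\{\ell,C_2\}\mu_2}{d(k,\ell)}\min\{v(i-1,k+1,\ell-1),v(i-1,k,\ell)\},$$ where terms with coefficient $0$ are read as $0$. A decision is optimal if the state it leads to attains the corresponding minimum; a policy is optimal if all of its decisions are. A policy is of collaborative (respectively independent) threshold type with threshold $N$ if it chooses collaborative (respectively independent) service when the number $i$ of jobs in queue is below $N$ and independent (respectively collaborative) service otherwise. *)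

theory Defs
  imports "HOL-Probability.Probability"
begin

record clearing_system =
  C\<^sub>1 :: nat
  C\<^sub>2 :: nat
  \<mu>\<^sub>1 :: real
  \<mu>\<^sub>2 :: real
  h\<^sub>0 :: real
  h\<^sub>1 :: real
  h\<^sub>2 :: real

text \<open>A state \<open>(i, k, l)\<close> has \<open>i\<close> jobs in the initial queue, \<open>k\<close> at Station 1
  and \<open>l\<close> at Station 2.\<close>

type_synonym state = "nat \<times> nat \<times> nat"

datatype station = Station1 | Station2

datatype decision = Independent | Collaborative

text \<open>A policy picks a decision from the current state and the station that completes a job next.
  Its values where the queue is empty are immaterial. States never recur, because every completion
  removes a job, so a stationary policy may use a different rule at every stage.\<close>

type_synonym policy = "state \<Rightarrow> station \<Rightarrow> decision"

definition states :: "clearing_system \<Rightarrow> state set" where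
  "states S = {(i, k, l). (i = 0 \<and> k + l < C\<^sub>1 S) \<or> (i \<ge> 0 \<and> k + l = C\<^sub>1 S)}"

definition decision_states :: "clearing_system \<Rightarrow> state set" where
  "decision_states S = {(i, k, l). (i, k, l) \<in> states S \<and> i \<ge> 1}"

fun busy :: "station \<Rightarrow> state \<Rightarrow> bool" where
  "busy Station1 (i, k, l) \<longleftrightarrow> k \<ge> 1"
| "busy Station2 (i, k, l) \<longleftrightarrow> l \<ge> 1"

fun service_rate :: "clearing_system \<Rightarrow> station \<Rightarrow> state \<Rightarrow> real" where
  "service_rate S Station1 (i, k, l) = real k * \<mu>\<^sub>1 S"
| "service_rate S Station2 (i, k, l) = real (min l (C\<^sub>2 S)) * \<mu>\<^sub>2 S"

definition total_rate :: "clearing_system \<Rightarrow> state \<Rightarrow> real" where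
  "total_rate S x = service_rate S Station1 x + service_rate S Station2 x"

fun holding_rate :: "clearing_system \<Rightarrow> state \<Rightarrow> real" where
  "holding_rate S (i, k, l) = real i * h\<^sub>0 S + real k * h\<^sub>1 S + real l * h\<^sub>2 S"

text \<open>Subtraction on \<open>nat\<close> truncates, so \<open>next_state s a x\<close> is meaningful only if \<open>busy s x\<close>.\<close>

fun next_state :: "station \<Rightarrow> decision \<Rightarrow> state \<Rightarrow> state" where
  "next_state Station1 a (i, k, l) =
     (if i = 0 then (0, k - 1, l)
      else case a of Independent \<Rightarrow> (i - 1, k, l) | Collaborative \<Rightarrow> (i - 1, k - 1, l + 1))"
| "next_state Station2 a (i, k, l) =
     (if i = 0 then (0, k, l - 1)
      else case a of Independent \<Rightarrow> (i - 1, k + 1, l - 1) | Collaborative \<Rightarrow> (i - 1, k, l))"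

definition next_completion :: "clearing_system \<Rightarrow> state \<Rightarrow> station pmf" where
  "next_completion S x =
     map_pmf (\<lambda>b. if b then Station1 else Station2)
       (bernoulli_pmf (service_rate S Station1 x / total_rate S x))"

text \<open>The law of the holding cost accumulated over the next \<open>n\<close> service completions: the time to
  the next completion is exponential with rate \<open>total_rate S x\<close>, is independent of which station
  completes, and cost accrues at rate \<open>holding_rate S x\<close> meanwhile.\<close>

primrec cost_law :: "clearing_system \<Rightarrow> policy \<Rightarrow> nat \<Rightarrow> state \<Rightarrow> real measure" where
  "cost_law S \<pi> 0 x = return borel 0"
| "cost_law S \<pi> (Suc n) x =
     measure_pmf (next_completion S x) \<bind>
       (\<lambda>s. distr (density lborel (exponential_density (total_rate S x))
                     \<Otimes>\<^sub>M cost_law S \<pi> n (next_state s (\<pi> x s) x))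
              borel (\<lambda>(t, c). holding_rate S x * t + c))"

text \<open>Each completion removes exactly one job, so the system is empty after as many completions
  as there are jobs.\<close>

fun jobs :: "state \<Rightarrow> nat" where
  "jobs (i, k, l) = i + k + l"

definition expected_cost :: "clearing_system \<Rightarrow> policy \<Rightarrow> state \<Rightarrow> real" where
  "expected_cost S \<pi> x = (LINT c | cost_law S \<pi> (jobs x) x. c)"

definition value_fn :: "clearing_system \<Rightarrow> state \<Rightarrow> real" where
  "value_fn S x = (INF \<pi>. expected_cost S \<pi> x)"

definition optimal_decision :: "clearing_system \<Rightarrow> state \<Rightarrow> station \<Rightarrow> decision \<Rightarrow> bool" where
  "optimal_decision S x s a \<longleftrightarrow>
     value_fn S (next_state s a x) =
       min (value_fn S (next_state s Independent x)) (value_fn S (next_state s Collaborative x))"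

definition optimal_policy :: "clearing_system \<Rightarrow> policy \<Rightarrow> bool" where
  "optimal_policy S \<pi> \<longleftrightarrow>
     (\<forall>x \<in> decision_states S. \<forall>s. busy s x \<longrightarrow> optimal_decision S x s (\<pi> x s))"

text \<open>The threshold rules describe a policy at the decision states with \<open>l\<close> jobs at Station 2 when
  Station \<open>s\<close> completes a job, since the thresholds depend on both.\<close>

definition collaborative_threshold ::
  "clearing_system \<Rightarrow> policy \<Rightarrow> station \<Rightarrow> nat \<Rightarrow> nat \<Rightarrow> bool" where
  "collaborative_threshold S \<pi> s l N \<longleftrightarrow>
     (\<forall>i k. (i, k, l) \<in> decision_states S \<and> busy s (i, k, l) \<longrightarrow>
        \<pi> (i, k, l) s = (if i < N then Collaborative else Independent))"

definition independent_threshold ::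
  "clearing_system \<Rightarrow> policy \<Rightarrow> station \<Rightarrow> nat \<Rightarrow> nat \<Rightarrow> bool" where
  "independent_threshold S \<pi> s l N \<longleftrightarrow>
     (\<forall>i k. (i, k, l) \<in> decision_states S \<and> busy s (i, k, l) \<longrightarrow>
        \<pi> (i, k, l) s = (if i < N then Independent else Collaborative))"

lemma jobs_next_state: "busy s x \<Longrightarrow> jobs (next_state s a x) = jobs x - 1"
  by (cases s; cases a; cases x) auto

lemma next_state_in_states: "x \<in> states S \<Longrightarrow> busy s x \<Longrightarrow> next_state s a x \<in> states S"
  by (cases s; cases a; cases x) (auto simp: states_def)

lemma nn_integral_exponential:
  assumes "0 < l"
  shows "(\<integral>\<^sup>+t. ennreal t \<partial>density lborel (exponential_density l)) = ennreal (1 / l)"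
proof -
  have "(\<integral>\<^sup>+t. ennreal t \<partial>density lborel (exponential_density l))
      = (\<integral>\<^sup>+t. ennreal (exponential_density l t * t ^ 1) \<partial>lborel)"
    using assms by (subst nn_integral_density)
      (auto intro!: nn_integral_cong simp: ennreal_mult'' exponential_density_def ennreal_neg
        simp flip: ennreal_mult')
  also have "\<dots> = ennreal (1 / l)"
    using nn_integral_erlang_ith_moment[OF assms, of 0 1] by simp
  finally show ?thesis .
qed

lemma nn_integral_affine:
  fixes M N :: "real measure" and r :: real
  assumes "prob_space M" "sets M = sets borel" "AE t in M. 0 \<le> t" "(\<integral>\<^sup>+t. ennreal t \<partial>M) = ennreal a"
    and "prob_space N" "sets N = sets borel" "AE c in N. 0 \<le> c" "(\<integral>\<^sup>+c. ennreal c \<partial>N) = ennreal b"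
    and "0 \<le> r" "0 \<le> a" "0 \<le> b"
  defines "D \<equiv> distr (M \<Otimes>\<^sub>M N) borel (\<lambda>(t, c). r * t + c)"
  shows "prob_space D" "AE c in D. 0 \<le> c" "(\<integral>\<^sup>+c. ennreal c \<partial>D) = ennreal (r * a + b)"
proof -
  interpret M: prob_space M by fact
  interpret N: prob_space N by fact
  interpret P: pair_prob_space M N ..
  note [measurable_cong] = assms(2,6)
  show "prob_space D"
    unfolding D_def by (rule P.prob_space_distr) measurable
  have nonneg: "AE p in M \<Otimes>\<^sub>M N. 0 \<le> fst p \<and> 0 \<le> snd p"
  proof (rule P.AE_pair_measure)
    show "AE x in M. AE y in N. 0 \<le> fst (x, y) \<and> 0 \<le> snd (x, y)"
      using assms(3)
    proof eventually_elim
      case (elim t)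
      then show ?case using assms(7) by auto
    qed
  qed measurable
  then have "AE p in M \<Otimes>\<^sub>M N. 0 \<le> (case p of (t, c) \<Rightarrow> r * t + c)"
    by (rule AE_mp) (use \<open>0 \<le> r\<close> in \<open>auto simp: split_beta\<close>)
  then show "AE c in D. 0 \<le> c"
    unfolding D_def by (subst AE_distr_iff) simp_all
  have "(\<integral>\<^sup>+c. ennreal c \<partial>D) = (\<integral>\<^sup>+p. ennreal (case p of (t, c) \<Rightarrow> r * t + c) \<partial>(M \<Otimes>\<^sub>M N))"
    unfolding D_def by (rule nn_integral_distr) measurable
  also have "\<dots> = (\<integral>\<^sup>+p. (case p of (t, c) \<Rightarrow> ennreal r * ennreal t + ennreal c) \<partial>(M \<Otimes>\<^sub>M N))"
    by (rule nn_integral_cong_AE, rule AE_mp[OF nonneg])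
       (use \<open>0 \<le> r\<close> in \<open>auto simp: ennreal_mult ennreal_plus\<close>)
  also have "\<dots> = (\<integral>\<^sup>+t. \<integral>\<^sup>+c. ennreal r * ennreal t + ennreal c \<partial>N \<partial>M)"
    by (subst N.nn_integral_fst[symmetric]) auto
  also have "\<dots> = (\<integral>\<^sup>+t. ennreal r * ennreal t + ennreal b \<partial>M)"
    by (intro nn_integral_cong) (simp add: nn_integral_add N.emeasure_space_1 assms(8))
  also have "\<dots> = ennreal (r * a + b)"
    using assms by (simp add: nn_integral_add nn_integral_cmult M.emeasure_space_1 ennreal_mult ennreal_plus)
  finally show "(\<integral>\<^sup>+c. ennreal c \<partial>D) = ennreal (r * a + b)" .
qed

locale positive_clearing_system =
  fixes S :: clearing_system
  assumes pos: "C\<^sub>1 S \<ge> 1" "C\<^sub>2 S \<ge> 1" "\<mu>\<^sub>1 S > 0" "\<mu>\<^sub>2 S > 0" "h\<^sub>0 S > 0" "h\<^sub>1 S > 0" "h\<^sub>2 S > 0"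
begin

text \<open>The invariant below survives completions at an idle station, which \<open>cost_law\<close> weighs with
  probability 0.\<close>

definition regular :: "nat \<Rightarrow> state \<Rightarrow> bool" where
  "regular n x \<longleftrightarrow> (case x of (i, k, l) \<Rightarrow> n \<le> i + k + l \<and> (i = 0 \<or> 0 < k + l))"

lemma regular_jobs: "x \<in> states S \<Longrightarrow> regular (jobs x) x"
  using pos by (cases x) (auto simp: regular_def states_def)

lemma regular_next: "regular (Suc n) x \<Longrightarrow> regular n (next_state s a x)"
  by (cases s; cases a; cases x) (auto simp: regular_def)

lemma service_rate_nonneg: "0 \<le> service_rate S s x"
  using pos by (cases s; cases x) auto

lemma service_rate_eq_0_iff: "service_rate S s x = 0 \<longleftrightarrow> \<not> busy s x"
  using pos by (cases s; cases x) (auto simp: min_def)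

lemma total_rate_pos:
  assumes "regular (Suc n) x"
  shows "0 < total_rate S x"
proof -
  have "busy Station1 x \<or> busy Station2 x"
    using assms by (cases x) (auto simp: regular_def)
  then have "0 < service_rate S Station1 x \<or> 0 < service_rate S Station2 x"
    using service_rate_nonneg[of Station1 x] service_rate_nonneg[of Station2 x]
      service_rate_eq_0_iff[of Station1 x] service_rate_eq_0_iff[of Station2 x] by linarith
  then show ?thesis
    using service_rate_nonneg[of Station1 x] service_rate_nonneg[of Station2 x]
    by (auto simp: total_rate_def)
qed

lemma holding_rate_nonneg: "0 \<le> holding_rate S x"
  using pos by (cases x) auto

primrec policy_cost :: "policy \<Rightarrow> nat \<Rightarrow> state \<Rightarrow> real" where
  "policy_cost \<pi> 0 x = 0"
| "policy_cost \<pi> (Suc n) x = holding_rate S x / total_rate S x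
     + service_rate S Station1 x / total_rate S x * policy_cost \<pi> n (next_state Station1 (\<pi> x Station1) x)
     + service_rate S Station2 x / total_rate S x * policy_cost \<pi> n (next_state Station2 (\<pi> x Station2) x)"

lemma total_rate_nonneg: "0 \<le> total_rate S x"
  by (simp add: total_rate_def service_rate_nonneg)

lemma policy_cost_nonneg: "0 \<le> policy_cost \<pi> n x"
  by (induction n arbitrary: x)
     (auto intro!: add_nonneg_nonneg mult_nonneg_nonneg divide_nonneg_nonneg
       simp: holding_rate_nonneg service_rate_nonneg total_rate_nonneg)

lemma nn_integral_next_completion:
  assumes "0 < total_rate S x"
  shows "(\<integral>\<^sup>+s. f s \<partial>next_completion S x) =
    ennreal (service_rate S Station1 x / total_rate S x) * f Station1
    + ennreal (service_rate S Station2 x / total_rate S x) * f Station2"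
proof -
  let ?p = "service_rate S Station1 x / total_rate S x"
  have p: "0 \<le> ?p" "?p \<le> 1" "1 - ?p = service_rate S Station2 x / total_rate S x"
    using assms service_rate_nonneg[of Station1 x] service_rate_nonneg[of Station2 x]
    by (auto simp: total_rate_def field_simps)
  show ?thesis
    unfolding next_completion_def using p by (simp add: mult.commute)
qed

lemma cost_law_aux:
  assumes "regular n x"
  shows "prob_space (cost_law S \<pi> n x) \<and> sets (cost_law S \<pi> n x) = sets borel
    \<and> (AE c in cost_law S \<pi> n x. 0 \<le> c)
    \<and> (\<integral>\<^sup>+c. ennreal c \<partial>cost_law S \<pi> n x) = ennreal (policy_cost \<pi> n x)"
  using assms
proof (induction n arbitrary: x)
  case 0
  have "AE c in cost_law S \<pi> 0 x. 0 \<le> c"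
    unfolding cost_law.simps by (subst AE_return) auto
  then show ?case by (simp add: prob_space_return nn_integral_return)
next
  case (Suc n)
  define E where "E = density lborel (exponential_density (total_rate S x))"
  define D where "D s = distr (E \<Otimes>\<^sub>M cost_law S \<pi> n (next_state s (\<pi> x s) x)) borel
    (\<lambda>(t, c). holding_rate S x * t + c)" for s
  have law: "cost_law S \<pi> (Suc n) x = measure_pmf (next_completion S x) \<bind> D"
    by (simp add: D_def[abs_def] E_def)
  have rate: "0 < total_rate S x" using Suc.prems by (rule total_rate_pos)
  have E: "prob_space E" "sets E = sets borel" "(\<integral>\<^sup>+t. ennreal t \<partial>E) = ennreal (1 / total_rate S x)"
    unfolding E_def using rate
    by (auto intro: prob_space_exponential_density nn_integral_exponential)
  have E_nonneg: "AE t in E. 0 \<le> t"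
    unfolding E_def by (subst AE_density) (auto simp: exponential_density_def)
  have t: "0 \<le> 1 / total_rate S x" using rate by simp
  note IH = Suc.IH[OF regular_next[OF Suc.prems]]
  have D: "prob_space (D s)" "AE c in D s. 0 \<le> c" "(\<integral>\<^sup>+c. ennreal c \<partial>D s)
    = ennreal (holding_rate S x * (1 / total_rate S x) + policy_cost \<pi> n (next_state s (\<pi> x s) x))" for s
    unfolding D_def
    by (rule nn_integral_affine[OF E(1,2) E_nonneg E(3) IH[THEN conjunct1]
          IH[THEN conjunct2, THEN conjunct1] IH[THEN conjunct2, THEN conjunct2, THEN conjunct1]
          IH[THEN conjunct2, THEN conjunct2, THEN conjunct2] holding_rate_nonneg t policy_cost_nonneg])+
  have sets_D: "sets (D s) = sets borel" for s by (simp add: D_def)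
  then have D_meas: "D \<in> measure_pmf (next_completion S x) \<rightarrow>\<^sub>M subprob_algebra borel"
    using D(1) by (simp add: space_subprob_algebra prob_space_imp_subprob_space)
  have "prob_space (cost_law S \<pi> (Suc n) x)"
    unfolding law using D(1) D_meas
    by (intro prob_space.prob_space_bind[where S=borel] prob_space_measure_pmf) auto
  moreover have "sets (cost_law S \<pi> (Suc n) x) = sets borel"
    unfolding law by (rule sets_bind) (simp_all add: sets_D)
  moreover have "AE c in cost_law S \<pi> (Suc n) x. 0 \<le> c"
    unfolding law using D(2) by (subst AE_bind[OF D_meas]) auto
  moreover have "(\<integral>\<^sup>+c. ennreal c \<partial>cost_law S \<pi> (Suc n) x) = ennreal (policy_cost \<pi> (Suc n) x)"
  proof -
    let ?c = "holding_rate S x * (1 / total_rate S x)"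
    let ?p = "\<lambda>s. service_rate S s x / total_rate S x"
    let ?J = "\<lambda>s. policy_cost \<pi> n (next_state s (\<pi> x s) x)"
    have p: "0 \<le> ?p s" for s
      using rate service_rate_nonneg by simp
    have sum1: "?p Station1 + ?p Station2 = 1"
      using rate by (simp add: total_rate_def flip: add_divide_distrib)
    have J: "0 \<le> ?c + ?J s" for s
      using rate holding_rate_nonneg policy_cost_nonneg by simp
    have "(\<integral>\<^sup>+c. ennreal c \<partial>cost_law S \<pi> (Suc n) x)
      = (\<integral>\<^sup>+s. \<integral>\<^sup>+c. ennreal c \<partial>D s \<partial>next_completion S x)"
      unfolding law by (subst nn_integral_bind[OF _ D_meas]) auto
    also have "\<dots> = ennreal (?p Station1) * ennreal (?c + ?J Station1)
        + ennreal (?p Station2) * ennreal (?c + ?J Station2)"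
      unfolding nn_integral_next_completion[OF rate] D(3) ..
    also have "\<dots> = ennreal (?p Station1 * (?c + ?J Station1) + ?p Station2 * (?c + ?J Station2))"
      by (simp only: ennreal_mult[OF p J] ennreal_plus[OF mult_nonneg_nonneg[OF p J] mult_nonneg_nonneg[OF p J]])
    also have "?p Station1 * (?c + ?J Station1) + ?p Station2 * (?c + ?J Station2)
        = (?p Station1 + ?p Station2) * ?c + ?p Station1 * ?J Station1 + ?p Station2 * ?J Station2"
      by (simp only: distrib_left distrib_right ac_simps)
    finally show ?thesis
      unfolding sum1 by simp
  qed
  ultimately show ?case by blast
qed

lemmas cost_law = cost_law_aux[THEN conjunct1] cost_law_aux[THEN conjunct2, THEN conjunct1]
  cost_law_aux[THEN conjunct2, THEN conjunct2, THEN conjunct1]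
  cost_law_aux[THEN conjunct2, THEN conjunct2, THEN conjunct2]

lemma expected_cost_eq:
  assumes "x \<in> states S"
  shows "expected_cost S \<pi> x = policy_cost \<pi> (jobs x) x"
proof -
  note l = cost_law[OF regular_jobs[OF assms], of \<pi>]
  have "(\<lambda>c. c) \<in> borel_measurable (cost_law S \<pi> (jobs x) x)"
    by (subst measurable_cong_sets[OF l(2) refl]) simp
  then show ?thesis
    unfolding expected_cost_def
    by (subst integral_eq_nn_integral) (use l policy_cost_nonneg in auto)
qed

primrec minimal_cost :: "nat \<Rightarrow> state \<Rightarrow> real" where
  "minimal_cost 0 x = 0"
| "minimal_cost (Suc n) x = holding_rate S x / total_rate S x
     + service_rate S Station1 x / total_rate S x * min (minimal_cost n (next_state Station1 Independent x))
         (minimal_cost n (next_state Station1 Collaborative x))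
     + service_rate S Station2 x / total_rate S x * min (minimal_cost n (next_state Station2 Independent x))
         (minimal_cost n (next_state Station2 Collaborative x))"

lemma minimal_cost_le: "minimal_cost n x \<le> policy_cost \<pi> n x"
proof (induction n arbitrary: x)
  case (Suc n)
  have "min (minimal_cost n (next_state s Independent x)) (minimal_cost n (next_state s Collaborative x))
      \<le> policy_cost \<pi> n (next_state s (\<pi> x s) x)" for s
    using Suc[of "next_state s (\<pi> x s) x"] by (cases "\<pi> x s") auto
  then show ?case
    unfolding minimal_cost.simps policy_cost.simps
    by (intro add_mono mult_left_mono divide_nonneg_nonneg service_rate_nonneg total_rate_nonneg order_refl)
qed simp

definition greedy :: policy where
  "greedy x s = (if minimal_cost (jobs x - 1) (next_state s Independent x)
     \<le> minimal_cost (jobs x - 1) (next_state s Collaborative x) then Independent else Collaborative)"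

lemma policy_cost_greedy: "n = jobs x \<Longrightarrow> policy_cost greedy n x = minimal_cost n x"
proof (induction n arbitrary: x)
  case (Suc n)
  have "service_rate S s x / total_rate S x * policy_cost greedy n (next_state s (greedy x s) x)
      = service_rate S s x / total_rate S x * min (minimal_cost n (next_state s Independent x))
         (minimal_cost n (next_state s Collaborative x))" for s
  proof (cases "busy s x")
    case True
    then have "n = jobs (next_state s (greedy x s) x)"
      using Suc.prems by (simp add: jobs_next_state)
    then have "policy_cost greedy n (next_state s (greedy x s) x) = minimal_cost n (next_state s (greedy x s) x)"
      by (rule Suc.IH)
    also have "\<dots> = min (minimal_cost n (next_state s Independent x)) (minimal_cost n (next_state s Collaborative x))"
      using Suc.prems[symmetric] by (auto simp: greedy_def)
    finally show ?thesis by simp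
  next
    case False
    then show ?thesis using service_rate_eq_0_iff by simp
  qed
  then show ?case by (simp only: policy_cost.simps minimal_cost.simps)
qed simp

lemma value_fn_eq: "x \<in> states S \<Longrightarrow> value_fn S x = minimal_cost (jobs x) x"
  unfolding value_fn_def
  by (intro antisym cINF_greatest cINF_lower2[where x=greedy] bdd_belowI2[where m="minimal_cost (jobs x) x"])
     (auto simp: expected_cost_eq policy_cost_greedy minimal_cost_le)

lemma value_fn_attained: "x \<in> states S \<Longrightarrow> \<exists>\<pi>. expected_cost S \<pi> x = value_fn S x"
  by (intro exI[of _ greedy]) (simp add: expected_cost_eq policy_cost_greedy value_fn_eq)

theorem value_fn_empty: "value_fn S (0, 0, 0) = 0"
  using pos by (simp add: value_fn_eq states_def)

lemma value_fn_rec: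
  assumes "x \<in> states S" "0 < jobs x"
  shows "value_fn S x = holding_rate S x / total_rate S x
     + service_rate S Station1 x / total_rate S x * min (value_fn S (next_state Station1 Independent x))
         (value_fn S (next_state Station1 Collaborative x))
     + service_rate S Station2 x / total_rate S x * min (value_fn S (next_state Station2 Independent x))
         (value_fn S (next_state Station2 Collaborative x))"
proof -
  obtain n where n: "jobs x = Suc n" using assms(2) by (cases "jobs x") auto
  have "service_rate S s x / total_rate S x * min (value_fn S (next_state s Independent x))
         (value_fn S (next_state s Collaborative x))
      = service_rate S s x / total_rate S x * min (minimal_cost n (next_state s Independent x))
         (minimal_cost n (next_state s Collaborative x))" for s
  proof (cases "busy s x")
    case True
    then show ?thesis
      using assms n by (simp add: value_fn_eq next_state_in_states jobs_next_state)
  next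
    case False
    then show ?thesis using service_rate_eq_0_iff by simp
  qed
  then show ?thesis by (simp only: value_fn_eq[OF assms(1)] n minimal_cost.simps)
qed

theorem value_fn_empty_queue:
  assumes "k + l \<le> C\<^sub>1 S" "(k, l) \<noteq> (0, 0)"
  defines "d \<equiv> real k * \<mu>\<^sub>1 S + real (min l (C\<^sub>2 S)) * \<mu>\<^sub>2 S"
  shows "value_fn S (0, k, l) = (real k * h\<^sub>1 S + real l * h\<^sub>2 S) / d
    + real k * \<mu>\<^sub>1 S / d * value_fn S (0, k - 1, l)
    + real (min l (C\<^sub>2 S)) * \<mu>\<^sub>2 S / d * value_fn S (0, k, l - 1)"
  using value_fn_rec[of "(0, k, l)"] assms(1,2) unfolding d_def
  by (simp add: states_def total_rate_def le_less)

theorem value_fn_decision_state: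
  assumes "1 \<le> i" "k + l = C\<^sub>1 S"
  defines "d \<equiv> real k * \<mu>\<^sub>1 S + real (min l (C\<^sub>2 S)) * \<mu>\<^sub>2 S"
  shows "value_fn S (i, k, l) = (real i * h\<^sub>0 S + real k * h\<^sub>1 S + real l * h\<^sub>2 S) / d
    + real k * \<mu>\<^sub>1 S / d * min (value_fn S (i - 1, k, l)) (value_fn S (i - 1, k - 1, l + 1))
    + real (min l (C\<^sub>2 S)) * \<mu>\<^sub>2 S / d
        * min (value_fn S (i - 1, k + 1, l - 1)) (value_fn S (i - 1, k, l))"
  using value_fn_rec[of "(i, k, l)"] assms(1,2) unfolding d_def
  by (simp add: states_def total_rate_def)

end

end

theory Submission
  imports Defs "HOL-Real_Asymp.Real_Asymp"
begin

text \<open>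
  A decision compares two states that differ by one job at Station 2 instead of Station 1, so
  everything is read off the signs of \<open>D i l = v (i, C - l - 1, l + 1) - v (i, C - l, l)\<close>, where
  \<open>C\<close> is the number of Type-I servers: a decision at queue length \<open>i + 1\<close> may be collaborative if
  \<open>D i l \<le> 0\<close> and independent if \<open>D i l \<ge> 0\<close>. Since \<open>C \<le> C\<^sub>2\<close>, no server ever waits for a
  collaborator, and \<open>D 0 l = h\<^sub>2 / \<mu>\<^sub>2 - h\<^sub>1 / \<mu>\<^sub>1\<close> for every \<open>l\<close>.

  Let \<open>w l\<close> be the probability that the next completion is at Station 2 when \<open>l\<close> jobs are there;
  it increases with \<open>l\<close>. Couple the next completions from levels \<open>l\<close> and \<open>l + 1\<close>. Both are at
  Station 2 with probability \<open>w l\<close> and both at Station 1 with probability \<open>1 - w (l + 1)\<close>. In the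
  remaining case Station 1 completes at level \<open>l\<close> and Station 2 at level \<open>l + 1\<close>; then both may
  continue from \<open>l\<close> or from \<open>l + 1\<close>, so the continuation costs cancel. The holding costs until the
  completion differ by exactly \<open>(w (l + 1) - w l) * E i\<close>, where
  \<open>E i = h\<^sub>2 / \<mu>\<^sub>2 - h\<^sub>1 / \<mu>\<^sub>1 + (i + 1) * h\<^sub>0 * (1 / \<mu>\<^sub>2 - 1 / \<mu>\<^sub>1) / C\<close>. Hence
  \<open>D (i + 1) l\<close> is a weighted average, with weights summing to 1, of \<open>E i\<close> and of two expressions
  in the neighbouring values \<open>D i\<close> (lemma \<open>switch_cost_Suc\<close>).

  Suppose \<open>\<mu>\<^sub>2 \<le> \<mu>\<^sub>1\<close>. Then \<open>E\<close> is nondecreasing and \<open>w\<close> is convex. Averaging gives \<open>D i l \<le> E i\<close>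
  (\<open>D_le_E\<close>), and this bound together with convexity makes \<open>D i\<close> nondecreasing in \<open>l\<close> wherever it is
  nonpositive (\<open>D_mono_or_pos\<close>). Consequently a difference that is nonnegative stays nonnegative
  for all longer queues (\<open>D_nonneg_Suc\<close>). If \<open>\<mu>\<^sub>2 < \<mu>\<^sub>1\<close>, then \<open>E\<close> tends to infinity while the
  averaged values stay bounded below, so each difference does become nonnegative
  (\<open>D_eventually_nonneg\<close>): these are the finite thresholds. The case \<open>\<mu>\<^sub>1 \<le> \<mu>\<^sub>2\<close> is the same
  argument with the two stations exchanged, which negates \<open>D\<close> and \<open>E\<close> and reflects \<open>l\<close>. The always
  optimal decisions arise when \<open>D 0\<close> already has the sign that persists.
\<close>

section \<open>Averaging recursions\<close>

text \<open>The recursion is isolated from the queueing model so that it can be used twice: for the value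
  differences themselves, and for their negatives with the stations exchanged. Only
  \<open>D i l\<close> with \<open>l < C\<close> is meaningful. The recursion also mentions \<open>D i (0 - 1)\<close>, which is \<open>D i 0\<close> as
  subtraction truncates, and \<open>D i C\<close>; both carry weight 0 because \<open>w 0 = 0\<close> and \<open>w C = 1\<close>.\<close>

locale averaging_recursion =
  fixes C :: nat and w :: "nat \<Rightarrow> real" and E :: "nat \<Rightarrow> real" and D :: "nat \<Rightarrow> nat \<Rightarrow> real"
  assumes w_0: "w 0 = 0" and w_C: "w C = 1"
    and w_strict: "l < C \<Longrightarrow> w l < w (Suc l)"
    and w_convex: "Suc l < C \<Longrightarrow> w (Suc l) - w l \<le> w (Suc (Suc l)) - w (Suc l)"
    and E_mono: "E i \<le> E (Suc i)"
    and D_0_le: "l < C \<Longrightarrow> D 0 l \<le> E 0"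
    and D_0_mono: "Suc l < C \<Longrightarrow> D 0 l \<le> D 0 (Suc l)"
    and D_Suc: "l < C \<Longrightarrow> D (Suc i) l =
      w l * (min 0 (D i l) + max 0 (D i (l - 1)))
      + (1 - w (Suc l)) * (max 0 (D i l) + min 0 (D i (Suc l)))
      + (w (Suc l) - w l) * E i"
begin

lemma w_nonneg: "l \<le> C \<Longrightarrow> 0 \<le> w l"
proof (induction l)
  case (Suc l)
  then show ?case using w_strict[of l] by simp
qed (simp add: w_0)

lemma w_le_1: "l \<le> C \<Longrightarrow> w l \<le> 1"
proof (induction rule: inc_induct)
  case (step l)
  then show ?case using w_strict[of l] by simp
qed (simp add: w_C)

text \<open>The weights are nonnegative and sum to 1. The bounds on \<open>x\<close> and \<open>y\<close> are required only where
  their weights can be nonzero, which is what excludes the meaningless values of \<open>D\<close>.\<close>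

lemma average_le:
  fixes x y z u :: real
  assumes "l < C" "l \<noteq> 0 \<Longrightarrow> x \<le> u" "Suc l < C \<Longrightarrow> y \<le> u" "z \<le> u"
  shows "w l * x + (1 - w (Suc l)) * y + (w (Suc l) - w l) * z \<le> u"
proof -
  have "w l * x \<le> w l * u"
    using assms w_nonneg[of l] by (cases "l = 0") (auto simp: w_0 intro: mult_left_mono)
  moreover have "(1 - w (Suc l)) * y \<le> (1 - w (Suc l)) * u"
    using assms w_le_1[of "Suc l"] w_C
    by (cases "Suc l = C") (auto intro: mult_left_mono)
  moreover have "(w (Suc l) - w l) * z \<le> (w (Suc l) - w l) * u"
    using assms w_strict[of l] by (intro mult_left_mono) auto
  ultimately show ?thesis by (simp add: algebra_simps)
qed

lemma average_ge:
  fixes x y z u :: real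
  assumes "l < C" "l \<noteq> 0 \<Longrightarrow> u \<le> x" "Suc l < C \<Longrightarrow> u \<le> y"
  shows "u + (w (Suc l) - w l) * (z - u) \<le> w l * x + (1 - w (Suc l)) * y + (w (Suc l) - w l) * z"
  using average_le[of l "-x" "-u" "-y" "-u"] assms by (simp add: algebra_simps)

text \<open>Both averaged expressions have the form \<open>min 0 p + max 0 q\<close> with \<open>p\<close> and \<open>q\<close> among the values
  \<open>D i\<close>. It is at most \<open>q\<close> if \<open>q > 0\<close> and at most \<open>p\<close> otherwise, so a bound on all of \<open>D i\<close> passes
  to the average.\<close>

lemma D_le_E: "l < C \<Longrightarrow> D i l \<le> E i"
proof (induction i arbitrary: l)
  case (Suc i)
  have "D (Suc i) l \<le> E i"
    unfolding D_Suc[OF Suc.prems]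
  proof (rule average_le[OF Suc.prems])
    show "min 0 (D i l) + max 0 (D i (l - 1)) \<le> E i" if "l \<noteq> 0"
      using Suc.IH[of l] Suc.IH[of "l - 1"] Suc.prems that by (simp add: min_def max_def) linarith
    show "max 0 (D i l) + min 0 (D i (Suc l)) \<le> E i" if "Suc l < C"
      using Suc.IH[of l] Suc.IH[of "Suc l"] that by (auto simp: min_def max_def)
  qed simp
  also have "\<dots> \<le> E (Suc i)" by (rule E_mono)
  finally show ?case .
qed (rule D_0_le)

text \<open>Where \<open>D i\<close> is positive at \<open>l + 1\<close>, so are \<open>E i\<close> and all later values, and the average stays
  positive. Where it is nonpositive, it is nondecreasing up to \<open>l + 1\<close> and every positive part to
  the left vanishes. Comparing the two averages with the common value \<open>D i (l + 1)\<close> then leaves the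
  terms \<open>(w (l + 1) - w l) * (E i - D i (l + 1))\<close> and
  \<open>(w (l + 2) - w (l + 1)) * (E i - D i (l + 1))\<close>, which convexity of \<open>w\<close> orders because
  \<open>D i (l + 1) \<le> E i\<close>.\<close>

lemma D_mono_or_pos: "Suc l < C \<Longrightarrow> D i (Suc l) > 0 \<or> D i l \<le> D i (Suc l)"
proof (induction i arbitrary: l)
  case (Suc i)
  let ?m = "Suc l"
  have l: "l < C" and m: "?m < C" using Suc.prems by auto
  have up: "0 < D i (Suc ?m) \<or> D i ?m \<le> D i (Suc ?m)" if "Suc ?m < C"
    using Suc.IH[OF that] .
  show ?case
  proof (cases "0 < D i ?m")
    case True
    then have "0 < E i" using D_le_E[OF m, of i] by linarith
    then have "0 < 0 + (w (Suc ?m) - w ?m) * (E i - 0)" using w_strict[OF m] by simp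
    also have "\<dots> \<le> D (Suc i) ?m"
      unfolding D_Suc[OF m] by (rule average_ge[OF m]) (use True up in auto)
    finally show ?thesis by simp
  next
    case False
    have below: "D i l \<le> D i ?m" "max 0 (D i l) = 0" using Suc.IH[OF m] False by auto
    have below2: "w l * max 0 (D i (l - 1)) = 0"
    proof (cases l)
      case (Suc l')
      then show ?thesis using Suc.IH[of l'] l below False by auto
    qed (simp add: w_0)
    let ?w0 = "w l" and ?w1 = "w ?m" and ?w2 = "w (Suc ?m)"
    have "D (Suc i) l = ?w0 * D i l + (1 - ?w1) * D i ?m + (?w1 - ?w0) * E i"
      unfolding D_Suc[OF l] using below below2 False by (simp add: distrib_left)
    also have "\<dots> \<le> ?w0 * D i ?m + (1 - ?w1) * D i ?m + (?w1 - ?w0) * E i"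
      using below(1) w_nonneg[of l] l by (simp add: mult_left_mono)
    also have "\<dots> = D i ?m + (?w1 - ?w0) * (E i - D i ?m)" by (simp add: algebra_simps)
    also have "\<dots> \<le> D i ?m + (?w2 - ?w1) * (E i - D i ?m)"
      using w_convex[OF m] D_le_E[OF m, of i] by (simp add: mult_right_mono)
    also have "\<dots> \<le> D (Suc i) ?m"
      unfolding D_Suc[OF m]
      by (rule average_ge[OF m]) (use up below False in \<open>auto simp: min_def max_def\<close>)
    finally show ?thesis ..
  qed
qed (simp add: D_0_mono)

text \<open>A nonnegative value at \<open>l\<close> forces \<open>E i\<close> and, by the previous lemma, the value at \<open>l + 1\<close> to be
  nonnegative. The only other negative part in the average is that of \<open>D i l\<close>, which is zero.\<close>

lemma D_nonneg_Suc:
  assumes "l < C" "0 \<le> D i l"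
  shows "0 \<le> D (Suc i) l"
proof -
  have "0 \<le> E i" using D_le_E[OF assms(1), of i] assms(2) by linarith
  then have "0 \<le> 0 + (w (Suc l) - w l) * (E i - 0)" using w_strict[OF assms(1)] by simp
  also have "\<dots> \<le> D (Suc i) l"
    unfolding D_Suc[OF assms(1)]
    by (rule average_ge[OF assms(1)]) (use assms(2) D_mono_or_pos[of l i] in auto)
  finally show ?thesis .
qed

lemma D_nonneg_mono: "l < C \<Longrightarrow> 0 \<le> D i l \<Longrightarrow> i \<le> j \<Longrightarrow> 0 \<le> D j l"
  by (rotate_tac 2, induction j rule: dec_induct) (auto intro: D_nonneg_Suc)

lemma D_bounded_below: "\<exists>b\<le>0. \<forall>i. \<forall>l<C. b \<le> D i l"
proof -
  define b where "b = Min (insert 0 (insert (E 0) (D 0 ` {..<C})))"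
  have b: "b \<le> 0" "b \<le> E 0" "\<And>l. l < C \<Longrightarrow> b \<le> D 0 l" 
    by (auto simp: b_def simp del: Min_insert intro!: Min_le)
  have bE: "b \<le> E i" for i
    using b(2) E_mono by (induction i) (auto intro: order_trans)
  have "b \<le> D i l" if "l < C" for i l
    using that
  proof (induction i arbitrary: l)
    case (Suc i)
    have "b \<le> b + (w (Suc l) - w l) * (E i - b)"
      using bE[of i] w_strict[OF Suc.prems] by simp
    also have "\<dots> \<le> D (Suc i) l"
      unfolding D_Suc[OF Suc.prems]
      by (rule average_ge[OF Suc.prems])
         (use b Suc.IH[of l] Suc.IH[of "Suc l"] Suc.prems in \<open>auto simp: min_def max_def\<close>)
    finally show ?case .
  qed (rule b)
  with b(1) show ?thesis by blast
qed

text \<open>The weight of \<open>E i\<close> at \<open>l\<close> is a positive constant, so a large \<open>E i\<close> outweighs the uniform lower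
  bound on the other averaged values in a single step.\<close>

lemma D_eventually_nonneg:
  assumes "filterlim E at_top sequentially" "l < C"
  shows "\<exists>i. 0 \<le> D i l"
proof -
  obtain b where b: "b \<le> 0" "\<And>i l. l < C \<Longrightarrow> b \<le> D i l" using D_bounded_below by blast
  define p where "p = w (Suc l) - w l"
  have p: "0 < p" using w_strict[OF assms(2)] by (simp add: p_def)
  \<comment> \<open>Solves \<open>0 \<le> b + p * (E i - b)\<close> for \<open>E i\<close>.\<close>
  obtain i where "b - b / p \<le> E i"
    using assms(1) unfolding filterlim_at_top eventually_sequentially by blast
  then have "0 \<le> b + p * (E i - b)" using p by (simp add: field_simps)
  also have "\<dots> \<le> D (Suc i) l"
    unfolding D_Suc[OF assms(2)] p_def
    by (rule average_ge[OF assms(2)])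
       (use b(1) b(2)[of l i] b(2)[of "Suc l" i] assms(2) in \<open>auto simp: min_def max_def\<close>)
  finally show ?thesis ..
qed

end

section \<open>Value differences form an averaging recursion\<close>

locale ample_collaborative_station = positive_clearing_system +
  assumes ample: "C\<^sub>1 S \<le> C\<^sub>2 S"
begin

abbreviation "C \<equiv> C\<^sub>1 S"

definition a\<^sub>1 :: real where "a\<^sub>1 = h\<^sub>1 S / \<mu>\<^sub>1 S"
definition a\<^sub>2 :: real where "a\<^sub>2 = h\<^sub>2 S / \<mu>\<^sub>2 S"

definition rate :: "nat \<Rightarrow> real" where "rate l = real (C - l) * \<mu>\<^sub>1 S + real l * \<mu>\<^sub>2 S"
definition share :: "nat \<Rightarrow> real" where "share l = real l * \<mu>\<^sub>2 S / rate l"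

definition cost_to_go :: "nat \<Rightarrow> nat \<Rightarrow> real" where
  "cost_to_go i l = value_fn S (i, C - l, l)"

definition switch_cost :: "nat \<Rightarrow> nat \<Rightarrow> real" where
  "switch_cost i l = cost_to_go i (Suc l) - cost_to_go i l"

text \<open>The extra mean service time of one job at Station 2 instead of Station 1, shared evenly by the
  \<open>C\<close> servers, is the delay that each queued job suffers; \<open>delay_cost\<close> is its price per queued
  job.\<close>

definition delay_cost :: real where
  "delay_cost = h\<^sub>0 S * ((1 / \<mu>\<^sub>2 S - 1 / \<mu>\<^sub>1 S) / real C)"

text \<open>The price of sending a single job to Station 2 rather than to Station 1 with \<open>i + 1\<close> jobs queued:
  the difference of its own mean holding costs, plus the delay that it inflicts on the queue.\<close>

definition isolated_switch_cost :: "nat \<Rightarrow> real" where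
  "isolated_switch_cost i = a\<^sub>2 - a\<^sub>1 + (real i + 1) * delay_cost"

text \<open>With an empty queue the remaining jobs are served simultaneously, and each pays its own mean
  holding cost.\<close>

lemma value_fn_empty_queue_eq:
  "k + l \<le> C \<Longrightarrow> value_fn S (0, k, l) = real k * a\<^sub>1 + real l * a\<^sub>2"
proof (induction "k + l" arbitrary: k l)
  case 0
  then show ?case using value_fn_empty by simp
next
  case (Suc n)
  define d where "d = real k * \<mu>\<^sub>1 S + real l * \<mu>\<^sub>2 S"
  have d: "0 < d"
    using Suc.hyps(2) pos by (cases "k = 0") (auto simp: d_def intro: add_pos_nonneg)
  have l: "min l (C\<^sub>2 S) = l" using Suc.prems ample by simp
  have 1: "real k * \<mu>\<^sub>1 S * value_fn S (0, k - 1, l) = real k * \<mu>\<^sub>1 S * ((real k - 1) * a\<^sub>1 + real l * a\<^sub>2)"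
    using Suc.hyps(1)[of "k - 1" l] Suc.hyps(2) Suc.prems by (cases k) auto
  have 2: "real l * \<mu>\<^sub>2 S * value_fn S (0, k, l - 1) = real l * \<mu>\<^sub>2 S * (real k * a\<^sub>1 + (real l - 1) * a\<^sub>2)"
    using Suc.hyps(1)[of k "l - 1"] Suc.hyps(2) Suc.prems by (cases l) auto
  have h: "h\<^sub>1 S = \<mu>\<^sub>1 S * a\<^sub>1" "h\<^sub>2 S = \<mu>\<^sub>2 S * a\<^sub>2" using pos by (auto simp: a\<^sub>1_def a\<^sub>2_def)
  have "value_fn S (0, k, l) = (real k * h\<^sub>1 S + real l * h\<^sub>2 S
      + real k * \<mu>\<^sub>1 S * value_fn S (0, k - 1, l) + real l * \<mu>\<^sub>2 S * value_fn S (0, k, l - 1)) / d"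
    using value_fn_empty_queue[of k l] Suc.prems Suc.hyps(2)
    unfolding l d_def by (force simp: add_divide_distrib)
  also have "\<dots> = (real k * a\<^sub>1 + real l * a\<^sub>2) * d / d"
    unfolding 1 2 h by (simp add: d_def algebra_simps)
  finally show ?case using d by simp
qed

lemma rate_pos: "l \<le> C \<Longrightarrow> 0 < rate l"
  using pos by (cases "l = C") (auto simp: rate_def intro: add_pos_nonneg)

lemma share_0: "share 0 = 0" and share_C: "share C = 1"
  using pos by (auto simp: share_def rate_def)

lemma one_minus_share: "l \<le> C \<Longrightarrow> 1 - share l = real (C - l) * \<mu>\<^sub>1 S / rate l"
  using rate_pos[of l] by (simp add: share_def rate_def field_simps)

lemma share_Suc_diff:
  assumes "l < C"
  shows "share (Suc l) - share l = real C * \<mu>\<^sub>1 S * \<mu>\<^sub>2 S / (rate l * rate (Suc l))"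
proof -
  have r: "rate l \<noteq> 0" "rate (Suc l) \<noteq> 0" using rate_pos[of l] rate_pos[of "Suc l"] assms by auto
  have "share (Suc l) - share l
      = (real (Suc l) * \<mu>\<^sub>2 S * rate l - real l * \<mu>\<^sub>2 S * rate (Suc l)) / (rate l * rate (Suc l))"
    using r by (simp add: share_def diff_frac_eq mult.commute)
  also have "real (Suc l) * \<mu>\<^sub>2 S * rate l - real l * \<mu>\<^sub>2 S * rate (Suc l) = real C * \<mu>\<^sub>1 S * \<mu>\<^sub>2 S"
    using assms by (simp add: rate_def of_nat_diff algebra_simps)
  finally show ?thesis .
qed

text \<open>As \<open>w = share l\<close> is the proportion of completions at Station 2, the mean service time
  \<open>w / \<mu>\<^sub>2 + (1 - w) / \<mu>\<^sub>1\<close> per completion equals \<open>C\<close> times the mean time between completions. What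
  matters is that \<open>1 / rate l\<close> is affine in \<open>share l\<close>: the queue's part of the holding cost then
  changes in proportion to \<open>share (Suc l) - share l\<close>, like every other part.\<close>

lemma inverse_rate:
  assumes "l \<le> C"
  shows "1 / rate l = (share l / \<mu>\<^sub>2 S + (1 - share l) / \<mu>\<^sub>1 S) / real C"
proof -
  have "share l / \<mu>\<^sub>2 S + (1 - share l) / \<mu>\<^sub>1 S = real C / rate l"
    unfolding one_minus_share[OF assms] using pos assms
    by (simp add: share_def of_nat_diff flip: add_divide_distrib)
  then show ?thesis using pos by simp
qed

text \<open>Each minimum is measured from \<open>cost_to_go i l\<close>, the state that both stations can lead to. At the
  ends \<open>l = C\<close> and \<open>l = 0\<close> the minimum of the idle station is meaningless but has coefficient 0.\<close>

lemma cost_to_go_Suc: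
  assumes "l \<le> C"
  shows "cost_to_go (Suc i) l = cost_to_go i l
    + (real i + 1) * h\<^sub>0 S / rate l + (1 - share l) * (a\<^sub>1 + min 0 (switch_cost i l))
    + share l * (a\<^sub>2 - max 0 (switch_cost i (l - 1)))"
proof -
  have l: "min l (C\<^sub>2 S) = l" using assms ample by simp
  have rate: "real (C - l) * \<mu>\<^sub>1 S + real l * \<mu>\<^sub>2 S = rate l" by (simp add: rate_def)
  let ?p = "1 - share l" and ?q = "share l"
  have p: "real (C - l) * \<mu>\<^sub>1 S / rate l = ?p" using one_minus_share[OF assms] by simp
  have q: "real l * \<mu>\<^sub>2 S / rate l = ?q" by (simp add: share_def)
  have h: "real (C - l) * h\<^sub>1 S = real (C - l) * \<mu>\<^sub>1 S * a\<^sub>1" "real l * h\<^sub>2 S = real l * \<mu>\<^sub>2 S * a\<^sub>2"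
    using pos by (auto simp: a\<^sub>1_def a\<^sub>2_def)
  have 1: "?p * min (value_fn S (i, C - l, l)) (value_fn S (i, C - l - 1, l + 1))
      = ?p * (cost_to_go i l + min 0 (switch_cost i l))"
  proof (cases "l = C")
    case True
    then show ?thesis using one_minus_share[OF assms] by simp
  next
    case False
    then show ?thesis using assms by (auto simp: cost_to_go_def switch_cost_def min_def)
  qed
  have 2: "?q * min (value_fn S (i, C - l + 1, l - 1)) (value_fn S (i, C - l, l))
      = ?q * (cost_to_go i l - max 0 (switch_cost i (l - 1)))"
  proof (cases l)
    case 0
    then show ?thesis by (simp add: share_def)
  next
    case (Suc m)
    then have "C - l + 1 = C - m" using assms by simp
    then show ?thesis using Suc by (auto simp: cost_to_go_def switch_cost_def min_def)
  qed
  have "cost_to_go (Suc i) l = ((real i + 1) * h\<^sub>0 S + real (C - l) * h\<^sub>1 S + real l * h\<^sub>2 S) / rate l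
      + ?p * min (value_fn S (i, C - l, l)) (value_fn S (i, C - l - 1, l + 1))
      + ?q * min (value_fn S (i, C - l + 1, l - 1)) (value_fn S (i, C - l, l))"
    using value_fn_decision_state[of "Suc i" "C - l" l] assms
    unfolding l rate p q by (simp add: cost_to_go_def)
  also have "((real i + 1) * h\<^sub>0 S + real (C - l) * h\<^sub>1 S + real l * h\<^sub>2 S) / rate l
      = (real i + 1) * h\<^sub>0 S / rate l
        + real (C - l) * \<mu>\<^sub>1 S / rate l * a\<^sub>1 + real l * \<mu>\<^sub>2 S / rate l * a\<^sub>2"
    unfolding h by (simp add: add_divide_distrib)
  finally show ?thesis unfolding 1 2 p q by (simp add: algebra_simps)
qed

lemma switch_cost_0: "l < C \<Longrightarrow> switch_cost 0 l = a\<^sub>2 - a\<^sub>1"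
  by (simp add: switch_cost_def cost_to_go_def value_fn_empty_queue_eq of_nat_diff algebra_simps)

text \<open>Subtracting the two one-step equations leaves \<open>switch_cost i l\<close> over. A Station 1 completion at
  level \<open>l\<close> removes the proportion \<open>1 - share l\<close> of its negative part, and a Station 2 completion at
  level \<open>Suc l\<close> removes the proportion \<open>share (Suc l)\<close> of its positive part, by switching level.
  What remains has the weights of the cases in which the same station completes at both levels, and
  the holding costs collect into \<open>isolated_switch_cost\<close>.\<close>

lemma switch_cost_Suc:
  assumes "l < C"
  shows "switch_cost (Suc i) l =
    share l * (min 0 (switch_cost i l) + max 0 (switch_cost i (l - 1)))
    + (1 - share (Suc l)) * (max 0 (switch_cost i l) + min 0 (switch_cost i (Suc l)))
    + (share (Suc l) - share l) * isolated_switch_cost i"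
proof -
  let ?D = "switch_cost i" and ?H = "(real i + 1) * h\<^sub>0 S"
  have split: "?D l = min 0 (?D l) + max 0 (?D l)" by auto
  have H: "?H / rate m = ?H * ((share m / \<mu>\<^sub>2 S + (1 - share m) / \<mu>\<^sub>1 S) / real C)" if "m \<le> C" for m
    using inverse_rate[OF that] by (metis mult.right_neutral times_divide_eq_right)
  have "switch_cost (Suc i) l = ?D l
      + (?H / rate (Suc l) + (1 - share (Suc l)) * (a\<^sub>1 + min 0 (?D (Suc l)))
          + share (Suc l) * (a\<^sub>2 - max 0 (?D l)))
      - (?H / rate l + (1 - share l) * (a\<^sub>1 + min 0 (?D l)) + share l * (a\<^sub>2 - max 0 (?D (l - 1))))"
    unfolding switch_cost_def[of "Suc i"] using assms
    by (simp add: cost_to_go_Suc) (simp add: switch_cost_def)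
  also have "?H / rate (Suc l) = ?H / rate l
      + (share (Suc l) - share l) * ((real i + 1) * delay_cost)"
    using H[of l] H[of "Suc l"] assms
    by (simp add: delay_cost_def algebra_simps add_divide_distrib diff_divide_distrib)
  finally show ?thesis
    unfolding isolated_switch_cost_def by (subst (asm) split) (simp add: algebra_simps)
qed

lemma share_strict: "l < C \<Longrightarrow> share l < share (Suc l)"
  using share_Suc_diff[of l] rate_pos[of l] rate_pos[of "Suc l"] pos
  by (subst diff_gt_0_iff_gt[symmetric]) simp

lemma rate_Suc: "l < C \<Longrightarrow> rate (Suc l) = rate l + (\<mu>\<^sub>2 S - \<mu>\<^sub>1 S)"
  by (simp add: rate_def of_nat_diff algebra_simps)

text \<open>By \<open>share_Suc_diff\<close> the increments of \<open>share\<close> are inversely proportional to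
  \<open>rate l * rate (Suc l)\<close>, and \<open>rate\<close> is nonincreasing here; hence \<open>share\<close> is convex.\<close>

lemma averaging_recursion_independent_faster:
  assumes "\<mu>\<^sub>2 S \<le> \<mu>\<^sub>1 S"
  shows "averaging_recursion C share isolated_switch_cost switch_cost"
proof
  have k: "0 \<le> delay_cost"
    using assms pos by (simp add: delay_cost_def frac_le)
  show "share 0 = 0" "share C = 1" by (fact share_0 share_C)+
  show "share l < share (Suc l)" if "l < C" for l using share_strict[OF that] .
  show "share (Suc l) - share l \<le> share (Suc (Suc l)) - share (Suc l)" if "Suc l < C" for l
  proof -
    have "rate (Suc l) * rate (Suc (Suc l)) \<le> rate l * rate (Suc l)"
      using rate_pos[of l] rate_pos[of "Suc l"] rate_Suc[of l] rate_Suc[of "Suc l"] that assms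
      by (simp add: mult.commute)
    then show ?thesis
      using that rate_pos[of "Suc l"] rate_pos[of "Suc (Suc l)"] pos
      by (simp add: share_Suc_diff) (intro divide_left_mono mult_pos_pos mult_nonneg_nonneg rate_pos, auto)
  qed
  show "isolated_switch_cost i \<le> isolated_switch_cost (Suc i)" for i
    using k by (simp add: isolated_switch_cost_def algebra_simps)
  show "switch_cost 0 l \<le> isolated_switch_cost 0" if "l < C" for l
    using k by (simp add: switch_cost_0[OF that] isolated_switch_cost_def)
  show "switch_cost 0 l \<le> switch_cost 0 (Suc l)" if "Suc l < C" for l
    using that by (simp add: switch_cost_0)
qed (rule switch_cost_Suc)

text \<open>Exchanging the stations turns level \<open>l\<close> into \<open>C - l\<close>, so the pair of levels \<open>l, l + 1\<close> becomes
  \<open>C - 1 - l, C - l\<close> in reverse order, which reverses the sign of the difference. This makes the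
  results for a faster Station 1 available for a faster Station 2.\<close>

lemma averaging_recursion_collaborative_faster:
  assumes "\<mu>\<^sub>1 S \<le> \<mu>\<^sub>2 S"
  shows "averaging_recursion C (\<lambda>l. 1 - share (C - l)) (\<lambda>i. - isolated_switch_cost i)
    (\<lambda>i l. - switch_cost i (C - 1 - l))"
proof
  have k: "delay_cost \<le> 0"
    unfolding delay_cost_def using assms pos by (intro mult_nonneg_nonpos divide_nonpos_nonneg) (auto simp: frac_le)
  show "1 - share (C - 0) = 0" "1 - share (C - C) = 1"
    by (simp_all add: share_0 share_C)
  show "1 - share (C - l) < 1 - share (C - Suc l)" if "l < C" for l
    using share_strict[of "C - Suc l"] that by (simp add: Suc_diff_Suc)
  show "1 - share (C - Suc l) - (1 - share (C - l))
      \<le> 1 - share (C - Suc (Suc l)) - (1 - share (C - Suc l))" if "Suc l < C" for l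
  proof -
    define m where "m = C - Suc (Suc l)"
    have m: "C - Suc l = Suc m" "C - l = Suc (Suc m)" "Suc m < C" using that by (auto simp: m_def)
    have "rate m * rate (Suc m) \<le> rate (Suc m) * rate (Suc (Suc m))"
      using rate_pos[of m] rate_pos[of "Suc m"] rate_Suc[of m] rate_Suc[of "Suc m"] m(3) assms
      by (simp add: mult.commute)
    then have "share (Suc (Suc m)) - share (Suc m) \<le> share (Suc m) - share m"
      using m(3) rate_pos[of "Suc m"] rate_pos[of "Suc (Suc m)"] pos
      by (simp add: share_Suc_diff) (intro divide_left_mono mult_pos_pos mult_nonneg_nonneg rate_pos, auto)
    then show ?thesis unfolding m(1,2) m_def[symmetric] by simp
  qed
  show "- isolated_switch_cost i \<le> - isolated_switch_cost (Suc i)" for i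
    using k by (simp add: isolated_switch_cost_def algebra_simps)
  show "- switch_cost 0 (C - 1 - l) \<le> - isolated_switch_cost 0" if "l < C" for l
    using k that by (simp add: switch_cost_0 isolated_switch_cost_def)
  show "- switch_cost 0 (C - 1 - l) \<le> - switch_cost 0 (C - 1 - Suc l)" if "Suc l < C" for l
    using that by (simp add: switch_cost_0)
next
  fix i l assume l: "l < C"
  define m where "m = C - Suc l"
  have m: "C - l = Suc m" "C - 1 - l = m" "m < C" "C - 1 - Suc l = m - 1" "C - Suc l = m"
    using l by (auto simp: m_def)
  have "(1 - share (Suc m)) * max 0 (- switch_cost i (C - 1 - (l - 1)))
      = (1 - share (Suc m)) * max 0 (- switch_cost i (Suc m))"
  proof (cases l)
    case 0
    then show ?thesis using m(1) share_C by simp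
  next
    case (Suc n)
    then have "C - 1 - (l - 1) = Suc m" using l by (simp add: m_def)
    then show ?thesis by simp
  qed
  moreover have "min 0 (- x) = - max 0 x" "max 0 (- x) = - min 0 x" for x :: real by auto
  ultimately show "- switch_cost (Suc i) (C - 1 - l) =
      (1 - share (C - l)) * (min 0 (- switch_cost i (C - 1 - l)) + max 0 (- switch_cost i (C - 1 - (l - 1))))
      + (1 - (1 - share (C - Suc l))) *
        (max 0 (- switch_cost i (C - 1 - l)) + min 0 (- switch_cost i (C - 1 - Suc l)))
      + (1 - share (C - Suc l) - (1 - share (C - l))) * - isolated_switch_cost i"
    unfolding m switch_cost_Suc[OF m(3)] by (simp add: algebra_simps)
qed

section \<open>Optimal decisions as signs of value differences\<close>

text \<open>After a completion at Station \<open>s\<close> the choice is between \<open>compared_level s l\<close> and one more job at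
  Station 2. That both stations share this form is the reason why a single family of thresholds
  serves them, shifted by one for Station 2.\<close>

definition compared_level :: "station \<Rightarrow> nat \<Rightarrow> nat" where
  "compared_level s l = (case s of Station1 \<Rightarrow> l | Station2 \<Rightarrow> l - 1)"

lemma compared_level_less:
  assumes "(i, k, l) \<in> decision_states S" "busy s (i, k, l)"
  shows "compared_level s l < C"
  using assms by (cases s) (auto simp: decision_states_def states_def compared_level_def)

definition preferred :: "decision \<Rightarrow> nat \<Rightarrow> nat \<Rightarrow> bool" where
  "preferred a i l = (case a of Independent \<Rightarrow> 0 \<le> switch_cost i l | Collaborative \<Rightarrow> switch_cost i l \<le> 0)"

lemma optimal_decision_iff:
  assumes "(i, k, l) \<in> decision_states S" "busy s (i, k, l)"
  shows "optimal_decision S (i, k, l) s a \<longleftrightarrow> preferred a (i - 1) (compared_level s l)"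
proof -
  have i: "1 \<le> i" and k: "k = C - l" and l: "l \<le> C"
    using assms(1) by (auto simp: decision_states_def states_def)
  have ind: "value_fn S (next_state s Independent (i, k, l)) = cost_to_go (i - 1) (compared_level s l)"
    using assms(2) i l unfolding k by (cases s) (simp_all add: cost_to_go_def compared_level_def Suc_diff_le)
  have coll: "value_fn S (next_state s Collaborative (i, k, l)) = cost_to_go (i - 1) (Suc (compared_level s l))"
    using assms(2) i l unfolding k by (cases s) (simp_all add: cost_to_go_def compared_level_def)
  show ?thesis
    unfolding optimal_decision_def by (cases a) (auto simp: ind coll preferred_def switch_cost_def)
qed

text \<open>The decision at queue length \<open>i\<close> depends on costs at queue length \<open>i - 1\<close>, so a change of
  preference at \<open>N\<close> becomes the threshold \<open>N + 1\<close>.\<close>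

definition level_threshold_policy :: "decision \<Rightarrow> decision \<Rightarrow> (nat \<Rightarrow> nat) \<Rightarrow> policy" where
  "level_threshold_policy a b N = (\<lambda>(i, k, l) s. if i < N (compared_level s l) + 1 then a else b)"

lemma level_threshold_policy_thresholds:
  "collaborative_threshold S (level_threshold_policy Collaborative Independent N) s l (N (compared_level s l) + 1)"
  "independent_threshold S (level_threshold_policy Independent Collaborative N) s l (N (compared_level s l) + 1)"
  by (simp_all add: collaborative_threshold_def independent_threshold_def level_threshold_policy_def)

lemma optimal_level_threshold_policy:
  assumes "\<And>i l. l < C \<Longrightarrow> i < N l \<Longrightarrow> preferred a i l" "\<And>i l. l < C \<Longrightarrow> N l \<le> i \<Longrightarrow> preferred b i l"
  shows "optimal_policy S (level_threshold_policy a b N)"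
  unfolding optimal_policy_def
proof clarify
  fix i k l s assume x: "(i, k, l) \<in> decision_states S" "busy s (i, k, l)"
  have "1 \<le> i" using x(1) by (simp add: decision_states_def)
  then show "optimal_decision S (i, k, l) s (level_threshold_policy a b N (i, k, l) s)"
    using compared_level_less[OF x] assms
    by (auto simp: optimal_decision_iff[OF x] level_threshold_policy_def)
qed

section \<open>Persistence and change of sign\<close>

lemma isolated_switch_cost_at_top:
  assumes "\<mu>\<^sub>2 S < \<mu>\<^sub>1 S"
  shows "filterlim isolated_switch_cost at_top sequentially"
proof -
  have "0 < delay_cost" using assms pos by (simp add: delay_cost_def frac_less2)
  then show ?thesis unfolding isolated_switch_cost_def by real_asymp
qed

lemma isolated_switch_cost_at_bot:
  assumes "\<mu>\<^sub>1 S < \<mu>\<^sub>2 S"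
  shows "filterlim (\<lambda>i. - isolated_switch_cost i) at_top sequentially"
proof -
  have "delay_cost < 0"
    unfolding delay_cost_def using assms pos
    by (intro mult_pos_neg divide_neg_pos) (auto simp: frac_less2)
  then show ?thesis unfolding isolated_switch_cost_def by real_asymp
qed

lemma switch_cost_nonneg_mono:
  assumes "\<mu>\<^sub>2 S \<le> \<mu>\<^sub>1 S" "l < C" "0 \<le> switch_cost i l" "i \<le> j"
  shows "0 \<le> switch_cost j l"
  using averaging_recursion.D_nonneg_mono[OF averaging_recursion_independent_faster] assms by blast

lemma switch_cost_nonpos_mono:
  assumes "\<mu>\<^sub>1 S \<le> \<mu>\<^sub>2 S" "l < C" "switch_cost i l \<le> 0" "i \<le> j"
  shows "switch_cost j l \<le> 0"
  using averaging_recursion.D_nonneg_mono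
      [OF averaging_recursion_collaborative_faster, of "C - 1 - l" i j] assms by simp

lemma switch_cost_eventually_nonneg:
  assumes "\<mu>\<^sub>2 S < \<mu>\<^sub>1 S" "l < C"
  shows "\<exists>i. 0 \<le> switch_cost i l"
  using averaging_recursion.D_eventually_nonneg
      [OF averaging_recursion_independent_faster isolated_switch_cost_at_top] assms by simp

lemma switch_cost_eventually_nonpos:
  assumes "\<mu>\<^sub>1 S < \<mu>\<^sub>2 S" "l < C"
  shows "\<exists>i. switch_cost i l \<le> 0"
  using averaging_recursion.D_eventually_nonneg
      [OF averaging_recursion_collaborative_faster isolated_switch_cost_at_bot, of "C - 1 - l"] assms
  by simp

text \<open>If Station 2 is faster, reflection turns \<open>D_mono_or_pos\<close> into: \<open>switch_cost i l\<close> is negative or at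
  most \<open>switch_cost i (Suc l)\<close>. Either alternative gives the claim, so the direction in which a
  nonpositive sign spreads is the same in both cases.\<close>

lemma switch_cost_nonpos_pred:
  assumes "Suc l < C" "switch_cost i (Suc l) \<le> 0"
  shows "switch_cost i l \<le> 0"
proof (cases "\<mu>\<^sub>2 S \<le> \<mu>\<^sub>1 S")
  case True
  then show ?thesis
    using averaging_recursion.D_mono_or_pos[OF averaging_recursion_independent_faster, of l i] assms
    by auto
next
  case False
  have "C - 1 - (C - Suc (Suc l)) = Suc l" "C - 1 - Suc (C - Suc (Suc l)) = l" "Suc (C - Suc (Suc l)) < C"
    using assms(1) by auto
  then show ?thesis
    using averaging_recursion.D_mono_or_pos
      [OF averaging_recursion_collaborative_faster, of "C - Suc (Suc l)" i] False assms(2) by auto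
qed

section \<open>Structure of optimal decisions\<close>

lemma collaborative_monotone:
  assumes "1 \<le> l" "(i, k, l) \<in> decision_states S" "(i, k + 1, l - 1) \<in> decision_states S"
    and "busy s (i, k, l)" "busy s (i, k + 1, l - 1)"
    and "optimal_decision S (i, k, l) s Collaborative"
  shows "optimal_decision S (i, k + 1, l - 1) s Collaborative"
proof -
  have "compared_level s l = Suc (compared_level s (l - 1))"
    using assms(1,4,5) by (cases s) (auto simp: compared_level_def)
  then show ?thesis
    using switch_cost_nonpos_pred assms compared_level_less[OF assms(2,4)] by (simp add: optimal_decision_iff preferred_def)
qed

lemma collaborative_always_optimal:
  assumes "a\<^sub>2 \<le> a\<^sub>1" "\<mu>\<^sub>1 S \<le> \<mu>\<^sub>2 S" "x \<in> decision_states S" "busy s x"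
  shows "optimal_decision S x s Collaborative"
proof (cases x)
  case (fields i k l)
  have "compared_level s l < C" using compared_level_less assms(3,4) fields by blast
  then show ?thesis
    using switch_cost_nonpos_mono[OF assms(2), of _ 0] switch_cost_0 assms fields
    by (simp add: optimal_decision_iff preferred_def)
qed

lemma independent_always_optimal:
  assumes "a\<^sub>1 \<le> a\<^sub>2" "\<mu>\<^sub>2 S \<le> \<mu>\<^sub>1 S" "x \<in> decision_states S" "busy s x"
  shows "optimal_decision S x s Independent"
proof (cases x)
  case (fields i k l)
  have "compared_level s l < C" using compared_level_less assms(3,4) fields by blast
  then show ?thesis
    using switch_cost_nonneg_mono[OF assms(2), of _ 0] switch_cost_0 assms fields
    by (simp add: optimal_decision_iff preferred_def)
qed

lemma collaborative_threshold_optimal: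
  assumes "\<mu>\<^sub>2 S < \<mu>\<^sub>1 S"
  shows "\<exists>N. optimal_policy S (level_threshold_policy Collaborative Independent N)"
proof (intro exI optimal_level_threshold_policy)
  let ?N = "\<lambda>l. LEAST i. 0 \<le> switch_cost i l"
  fix i l assume l: "l < C"
  show "preferred Collaborative i l" if "i < ?N l"
    using not_less_Least[OF that] by (simp add: preferred_def)
  show "preferred Independent i l" if "?N l \<le> i"
    using switch_cost_nonneg_mono[OF less_imp_le[OF assms] l _ that]
      LeastI_ex[OF switch_cost_eventually_nonneg[OF assms l]]
    by (simp add: preferred_def)
qed

lemma independent_threshold_optimal:
  assumes "\<mu>\<^sub>1 S < \<mu>\<^sub>2 S"
  shows "\<exists>N. optimal_policy S (level_threshold_policy Independent Collaborative N)"
proof (intro exI optimal_level_threshold_policy)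
  let ?N = "\<lambda>l. LEAST i. switch_cost i l \<le> 0"
  fix i l assume l: "l < C"
  show "preferred Independent i l" if "i < ?N l"
    using not_less_Least[OF that] by (simp add: preferred_def)
  show "preferred Collaborative i l" if "?N l \<le> i"
    using switch_cost_nonpos_mono[OF less_imp_le[OF assms] l _ that]
      LeastI_ex[OF switch_cost_eventually_nonpos[OF assms l]]
    by (simp add: preferred_def)
qed

text \<open>The condition under which independent service is always optimal for a faster Station 1 thus
  leads back to the case \<open>a\<^sub>1 \<le> a\<^sub>2\<close>, because \<open>m \<le> C \<le> C\<^sub>2\<close>.\<close>

lemma cost_le_if_le_scaled:
  assumes "m \<le> C" "a\<^sub>1 \<le> real m / real (C\<^sub>2 S) * a\<^sub>2"
  shows "a\<^sub>1 \<le> a\<^sub>2"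
proof -
  have "real m / real (C\<^sub>2 S) * a\<^sub>2 \<le> 1 * a\<^sub>2"
    using assms(1) ample pos by (intro mult_right_mono) (auto simp: a\<^sub>2_def)
  then show ?thesis using assms(2) by simp
qed

end

theorem theorem3p4:
  fixes S :: clearing_system
  assumes "C\<^sub>1 S \<ge> 1" and "C\<^sub>2 S \<ge> 1"
    and "\<mu>\<^sub>1 S > 0" and "\<mu>\<^sub>2 S > 0"
    and "h\<^sub>0 S > 0" and "h\<^sub>1 S > 0" and "h\<^sub>2 S > 0"
    and "C\<^sub>2 S \<ge> C\<^sub>1 S"
  shows
    "(h\<^sub>1 S / \<mu>\<^sub>1 S \<ge> h\<^sub>2 S / \<mu>\<^sub>2 S \<longrightarrow>
        (\<mu>\<^sub>1 S \<le> \<mu>\<^sub>2 S \<longrightarrow>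
           (\<forall>x \<in> decision_states S. \<forall>s. busy s x \<longrightarrow> optimal_decision S x s Collaborative)) \<and>
        (\<mu>\<^sub>1 S > \<mu>\<^sub>2 S \<longrightarrow>
           (\<exists>N\<^sub>1 :: nat \<Rightarrow> nat.
              (\<exists>\<pi>. optimal_policy S \<pi> \<and>
                 (\<forall>l \<in> {0..C\<^sub>1 S - 1}. collaborative_threshold S \<pi> Station1 l (N\<^sub>1 l + 1)) \<and>
                 (\<forall>l \<in> {1..C\<^sub>1 S}. collaborative_threshold S \<pi> Station2 l (N\<^sub>1 (l - 1) + 1))) \<and>
              (\<forall>i k l. (i, k, l) \<in> decision_states S \<and> k \<ge> 1 \<and>
                 h\<^sub>1 S / \<mu>\<^sub>1 S \<le> (real l + 1) / real (C\<^sub>2 S) * (h\<^sub>2 S / \<mu>\<^sub>2 S) \<longrightarrow>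
                 optimal_decision S (i, k, l) Station1 Independent) \<and>
              (\<forall>i k l. (i, k, l) \<in> decision_states S \<and> l \<ge> 1 \<and>
                 h\<^sub>1 S / \<mu>\<^sub>1 S \<le> real l / real (C\<^sub>2 S) * (h\<^sub>2 S / \<mu>\<^sub>2 S) \<longrightarrow>
                 optimal_decision S (i, k, l) Station2 Independent)))) \<and>
     (h\<^sub>1 S / \<mu>\<^sub>1 S \<le> h\<^sub>2 S / \<mu>\<^sub>2 S \<longrightarrow>
        (\<mu>\<^sub>1 S < \<mu>\<^sub>2 S \<longrightarrow>
           (\<exists>N\<^sub>3 :: nat \<Rightarrow> nat. \<exists>\<pi>. optimal_policy S \<pi> \<and>
              (\<forall>l \<in> {0..C\<^sub>1 S - 1}. independent_threshold S \<pi> Station1 l (N\<^sub>3 l + 1)) \<and>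
              (\<forall>l \<in> {1..C\<^sub>1 S}. independent_threshold S \<pi> Station2 l (N\<^sub>3 (l - 1) + 1)))) \<and>
        (\<mu>\<^sub>1 S \<ge> \<mu>\<^sub>2 S \<longrightarrow>
           (\<forall>x \<in> decision_states S. \<forall>s. busy s x \<longrightarrow> optimal_decision S x s Independent))) \<and>
     (\<forall>i k l. l \<ge> 1 \<and> (i, k, l) \<in> decision_states S \<and> (i, k + 1, l - 1) \<in> decision_states S \<longrightarrow>
        (k \<ge> 1 \<and> optimal_decision S (i, k, l) Station1 Collaborative \<longrightarrow>
           optimal_decision S (i, k + 1, l - 1) Station1 Collaborative) \<and>
        (l - 1 \<ge> 1 \<and> optimal_decision S (i, k, l) Station2 Collaborative \<longrightarrow>
           optimal_decision S (i, k + 1, l - 1) Station2 Collaborative))"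
proof -
  interpret ample_collaborative_station S
    by unfold_locales (use assms in auto)
  have independent: "optimal_decision S (i, k, l) s Independent"
    if "(i, k, l) \<in> decision_states S" "busy s (i, k, l)" "\<mu>\<^sub>2 S < \<mu>\<^sub>1 S"
      "a\<^sub>1 \<le> (real (compared_level s l) + 1) / real (C\<^sub>2 S) * a\<^sub>2" for i k l s
    using that compared_level_less[OF that(1,2)] cost_le_if_le_scaled[of "Suc (compared_level s l)"]
    by (intro independent_always_optimal) (auto simp: add.commute)
  show ?thesis
    unfolding a\<^sub>1_def[symmetric] a\<^sub>2_def[symmetric]
  proof (intro conjI impI)
    assume "\<mu>\<^sub>2 S < \<mu>\<^sub>1 S"
    then obtain N where opt: "optimal_policy S (level_threshold_policy Collaborative Independent N)"
      using collaborative_threshold_optimal by blast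
    note thr = level_threshold_policy_thresholds(1)[of N, unfolded compared_level_def]
    show "\<exists>N\<^sub>1 :: nat \<Rightarrow> nat.
        (\<exists>\<pi>. optimal_policy S \<pi> \<and>
           (\<forall>l \<in> {0..C - 1}. collaborative_threshold S \<pi> Station1 l (N\<^sub>1 l + 1)) \<and>
           (\<forall>l \<in> {1..C}. collaborative_threshold S \<pi> Station2 l (N\<^sub>1 (l - 1) + 1))) \<and>
        (\<forall>i k l. (i, k, l) \<in> decision_states S \<and> k \<ge> 1 \<and>
           a\<^sub>1 \<le> (real l + 1) / real (C\<^sub>2 S) * a\<^sub>2 \<longrightarrow>
           optimal_decision S (i, k, l) Station1 Independent) \<and>
        (\<forall>i k l. (i, k, l) \<in> decision_states S \<and> l \<ge> 1 \<and>
           a\<^sub>1 \<le> real l / real (C\<^sub>2 S) * a\<^sub>2 \<longrightarrow>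
           optimal_decision S (i, k, l) Station2 Independent)"
    proof (intro exI[of _ N] conjI exI[of _ "level_threshold_policy Collaborative Independent N"]
        opt ballI allI impI; (elim conjE)?)
      show "collaborative_threshold S (level_threshold_policy Collaborative Independent N) Station1 l (N l + 1)" for l
        using thr[of Station1 l] by simp
      show "collaborative_threshold S (level_threshold_policy Collaborative Independent N) Station2 l (N (l - 1) + 1)" for l
        using thr[of Station2 l] by simp
    next
      fix i k l assume "(i, k, l) \<in> decision_states S" "1 \<le> k" "a\<^sub>1 \<le> (real l + 1) / real (C\<^sub>2 S) * a\<^sub>2"
      then show "optimal_decision S (i, k, l) Station1 Independent"
        using independent[of i k l Station1] \<open>\<mu>\<^sub>2 S < \<mu>\<^sub>1 S\<close> by (simp add: compared_level_def)
    next
      fix i k l assume "(i, k, l) \<in> decision_states S" "1 \<le> l" "a\<^sub>1 \<le> real l / real (C\<^sub>2 S) * a\<^sub>2"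
      then show "optimal_decision S (i, k, l) Station2 Independent"
        using independent[of i k l Station2] \<open>\<mu>\<^sub>2 S < \<mu>\<^sub>1 S\<close> by (simp add: compared_level_def of_nat_diff)
    qed
  next
    assume "\<mu>\<^sub>1 S < \<mu>\<^sub>2 S"
    then obtain N where opt: "optimal_policy S (level_threshold_policy Independent Collaborative N)"
      using independent_threshold_optimal by blast
    note thr = level_threshold_policy_thresholds(2)[of N, unfolded compared_level_def]
    show "\<exists>N\<^sub>3 :: nat \<Rightarrow> nat. \<exists>\<pi>. optimal_policy S \<pi> \<and>
        (\<forall>l \<in> {0..C - 1}. independent_threshold S \<pi> Station1 l (N\<^sub>3 l + 1)) \<and>
        (\<forall>l \<in> {1..C}. independent_threshold S \<pi> Station2 l (N\<^sub>3 (l - 1) + 1))"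
    proof (intro exI[of _ N] exI[of _ "level_threshold_policy Independent Collaborative N"] conjI opt ballI)
      show "independent_threshold S (level_threshold_policy Independent Collaborative N) Station1 l (N l + 1)" for l
        using thr[of Station1 l] by simp
      show "independent_threshold S (level_threshold_policy Independent Collaborative N) Station2 l (N (l - 1) + 1)" for l
        using thr[of Station2 l] by simp
    qed
  next
    show "\<forall>x\<in>decision_states S. \<forall>s. busy s x \<longrightarrow> optimal_decision S x s Collaborative"
      if "a\<^sub>2 \<le> a\<^sub>1" "\<mu>\<^sub>1 S \<le> \<mu>\<^sub>2 S"
      using collaborative_always_optimal that by blast
    show "\<forall>x\<in>decision_states S. \<forall>s. busy s x \<longrightarrow> optimal_decision S x s Independent"
      if "a\<^sub>1 \<le> a\<^sub>2" "\<mu>\<^sub>2 S \<le> \<mu>\<^sub>1 S"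
      using independent_always_optimal that by blast
  qed (use collaborative_monotone in auto)
qed

end
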